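(* Let $(\Omega,\mathcal H)$ be a paved space, with $\mathcal H$ a ring of sets and $\Omega$ a countable disjoint union of elements of $\mathcal H$, and let $(X,\eta_1),(Y,\eta_2),(Z,\eta_3)$ be vector spaces with net convergence structures connected by a bilinear product $\bullet:X\times Y\to Z$, where $Z$ is a Riesz space and $\eta_3$ is $(D)$-convergence. Let $\mu:\mathcal H\to Y$ be a set function and let $f:\Omega\to X$ be $S^*$-integrable with respect to $\mu$ (i.e. $f\in L_{S^*}(\mu)$). Suppose that there are $P_0\in\mathcal P(\Omega)$ and a single $(D)$-sequence in $Z$ which, for every $P\in\mathcal P(\Omega)$ with $P\ge P_0$ and every choice function $\delta$, is a regulator for the (assumed) unconditional convergence of the series $\sum_{\alpha\in P}f(\delta_\alpha)\mu(\alpha)$. Then $f$ is Sion integrable with respect to $\mu$.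
   Context: A net convergence structure $\eta$ on a set $V$ assigns to each $v\in V$ a class of nets in $V$ ("converging to $v$") such that: (i) constant nets $v$ converge to $v$; (ii) every quasi-subnet of a net converging to $v$ converges to $v$, where $(y_j)_{j\in J}$ is a quasi-subnet of $(x_i)_{i\in I}$ if for every $i_0$ there is $j_0$ with $\{y_j:j\ge j_0\}\subseteq\{x_i:i\ge i_0\}$; (iii) if $(x_i)_{i\in I},(y_i)_{i\in I}$ converge to $v$ and $z_i\in\{x_i,y_i\}$ for all $i$, then $(z_i)$ converges to $v$. Standing assumptions: real vector spaces, Archimedean Riesz spaces, Hausdorff structures (unique limits; in particular for $(D)$-convergence on $Z$), continuous addition and multiplication by fixed reals. A paved space is a nonempty set $\Omega$ with $\mathcal H\subseteq 2^\Omega$, $\emptyset\in\mathcal H$. A bilinear product is a bilinear map, written by juxtaposition, continuous (preserving convergent nets) in each argument separately. A $(D)$-sequence (regulator) in a Riesz space is a double sequence $\{a_{ij}\}_{i,j\in\mathbb N}$ with $a_{ij}\ge a_{i,j+1}$ and $\bigwedge_j a_{ij}=0$ for every $i$. A net $(x_i)_{i\in I}$ $(D)$-converges to $x$ with regulator $\{a_{ij}\}$ if for every $\varphi\in\mathbb N^{\mathbb N}$ there is $i_0$ with $|x_i-x|\le\bigvee_{j=1}^\infty a_{j\varphi(j)}$ for all $i\ge i_0$ (the suprema being understood to exist). For $A\in\mathcal H$ (or $A=\Omega$), $\mathcal P(A)$ is the set of countable disjoint coverings $P=\{\alpha_j\}_j$ of $A$ by nonempty sets of $\mathcal H$, ordered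 by refinement: $P\le Q$ iff every member of $Q$ is contained in a member of $P$; $\mathcal P(A)$ is assumed nonempty and directed. A choice function $\delta$ assigns to each nonempty $\alpha\subseteq\Omega$ a point $\delta_\alpha\in\alpha$. A family $(z_j)_{j\in I}$ in $Z$ is unconditionally summable to $z$ if the net of finite sums $\big(\sum_{j\in J}z_j\big)_{J\subseteq I\text{ finite}}$, ordered by inclusion, converges to $z$; a regulator for this convergence is a regulator for this net. $f:\Omega\to X$ is $S^*$-integrable on $A$ with integral $z\in Z$ if there is $P_*\in\mathcal P(A)$ such that for all $P\ge P_*$ and all choice functions $\delta$ the series $\sum_{\alpha\in P}f(\delta_\alpha)\mu(\alpha)$ is unconditionally summable in $Z$, and the net of these sums converges to $z$ along refinement, independently of $\delta$ (i.e. as a net indexed by pairs $(P,\delta)$, $P\ge P_*$, preordered by refinement of $P$ only). $L_{S^*}(\mu)$ is the set of $f$ that are $S^*$-integrable on every $A\in\mathcal H$ (and on $\Omega$). Sion integral: a truncation is a map $\Delta$ assigning to each $P\in\mathcal P(\Omega)$ a finite subfamily $\Delta(P)\subseteq P$. Pairs $(P,\Delta)$ are ordered by $(Q,\Delta_2)\gg(P,\Delta_1)$ iff $Q$ refines $P$ and $\Delta_1(M)\subseteq\Delta_2(M)$ for every $M\in\mathcal P(\Omega)$ refining $Q$. $f$ is Sion integrable (on $\Omega$) if the sums $\sum_{\alpha\in\Delta(P)}f(\delta_\alpha)\mu(\alpha)$ converge in $Z$ along this order, independently of the choice of points $\delta_\alpha\in\alpha$ (i.e. as a net indexed by triples $(P,\delta,\Delta)$,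 preordered by $(P,\Delta)$ only). *)

theory Defs
  imports "HOL-Analysis.Analysis" "HOL-Library.Lub_Glb" "HOL-Library.Lattice_Algebras"
begin

section \<open>Archimedean Riesz spaces\<close>

class archimedean_riesz_space = ordered_real_vector + lattice_ab_group_add_abs +
  assumes archimedean: "0 \<le> x \<Longrightarrow> (\<And>n. of_nat n *\<^sub>R x \<le> y) \<Longrightarrow> x = 0"

section \<open>Nets and net convergence structures\<close>

text \<open>
  A net is given by a carrier \<open>I\<close> of indices, a directed preorder \<open>le\<close> on \<open>I\<close> and a function \<open>x\<close>
  of which only the values on \<open>I\<close> matter. HOL has no class of all nets, so a net convergence
  structure is formed over the nets whose index set is a subset of a given type \<open>'i\<close>.
  All statements are polymorphic in \<open>'i\<close>.
\<close>

definition directed_set :: "'i set \<Rightarrow> ('i \<Rightarrow> 'i \<Rightarrow> bool) \<Rightarrow> bool" where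
  "directed_set I le \<longleftrightarrow> I \<noteq> {} \<and>
     (\<forall>i\<in>I. le i i) \<and>
     (\<forall>i\<in>I. \<forall>j\<in>I. \<forall>k\<in>I. le i j \<longrightarrow> le j k \<longrightarrow> le i k) \<and>
     (\<forall>i\<in>I. \<forall>j\<in>I. \<exists>k\<in>I. le i k \<and> le j k)"

definition quasi_subnet ::
  "'j set \<Rightarrow> ('j \<Rightarrow> 'j \<Rightarrow> bool) \<Rightarrow> ('j \<Rightarrow> 'v) \<Rightarrow> 'i set \<Rightarrow> ('i \<Rightarrow> 'i \<Rightarrow> bool) \<Rightarrow> ('i \<Rightarrow> 'v) \<Rightarrow> bool" where
  "quasi_subnet J le' y I le x \<longleftrightarrow>
     (\<forall>i0\<in>I. \<exists>j0\<in>J. y ` {j\<in>J. le' j0 j} \<subseteq> x ` {i\<in>I. le i0 i})"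

type_synonym ('i, 'v) net_conv = "'i set \<Rightarrow> ('i \<Rightarrow> 'i \<Rightarrow> bool) \<Rightarrow> ('i \<Rightarrow> 'v) \<Rightarrow> 'v \<Rightarrow> bool"

definition net_convergence_structure :: "('i, 'v) net_conv \<Rightarrow> bool" where
  "net_convergence_structure \<eta> \<longleftrightarrow>
     (\<forall>I le x v. \<eta> I le x v \<longrightarrow> directed_set I le) \<and>
     (\<forall>I le v. directed_set I le \<longrightarrow> \<eta> I le (\<lambda>_. v) v) \<and>
     (\<forall>I le x v J le' y. \<eta> I le x v \<longrightarrow> directed_set J le' \<longrightarrow> quasi_subnet J le' y I le x
        \<longrightarrow> \<eta> J le' y v) \<and>
     (\<forall>I le x y z v. \<eta> I le x v \<longrightarrow> \<eta> I le y v \<longrightarrow> (\<forall>i\<in>I. z i \<in> {x i, y i}) \<longrightarrow> \<eta> I le z v)"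

definition convergence_vector_space :: "('i, 'v::real_vector) net_conv \<Rightarrow> bool" where
  "convergence_vector_space \<eta> \<longleftrightarrow> net_convergence_structure \<eta> \<and>
     (\<forall>I le x v w. \<eta> I le x v \<longrightarrow> \<eta> I le x w \<longrightarrow> v = w) \<and>
     (\<forall>I le x y v w. \<eta> I le x v \<longrightarrow> \<eta> I le y w \<longrightarrow> \<eta> I le (\<lambda>i. x i + y i) (v + w)) \<and>
     (\<forall>I le x v c. \<eta> I le x v \<longrightarrow> \<eta> I le (\<lambda>i. c *\<^sub>R x i) (c *\<^sub>R v))"

section \<open>\<open>(D)\<close>-convergence\<close>

definition D_sequence :: "(nat \<Rightarrow> nat \<Rightarrow> 'z::archimedean_riesz_space) \<Rightarrow> bool" where
  "D_sequence a \<longleftrightarrow> (\<forall>i j. a i (Suc j) \<le> a i j) \<and> (\<forall>i. isGlb UNIV (range (a i)) 0)"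

text \<open>The existence of the suprema \<open>\<Or>j. a j (\<phi> j)\<close> is part of being a regulator.\<close>

definition D_converges_reg ::
  "(nat \<Rightarrow> nat \<Rightarrow> 'z::archimedean_riesz_space) \<Rightarrow> ('i, 'z) net_conv" where
  "D_converges_reg a I le x v \<longleftrightarrow> directed_set I le \<and> D_sequence a \<and>
     (\<forall>\<phi> :: nat \<Rightarrow> nat. \<exists>s. isLub UNIV (range (\<lambda>j. a j (\<phi> j))) s \<and>
        (\<exists>i0\<in>I. \<forall>i\<in>I. le i0 i \<longrightarrow> \<bar>x i - v\<bar> \<le> s))"

definition D_converges :: "('i, 'z::archimedean_riesz_space) net_conv" where
  "D_converges I le x v \<longleftrightarrow> (\<exists>a. D_converges_reg a I le x v)"

text \<open>Uniqueness of \<open>(D)\<close>-limits does not depend on the type of the indices.\<close>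

lemma D_converges_unique_transfer:
  fixes v w :: "'z::archimedean_riesz_space" and J :: "'j set"
  assumes unique: "\<And>(I :: 'i set) le (x :: 'i \<Rightarrow> 'z) v w.
      D_converges I le x v \<Longrightarrow> D_converges I le x w \<Longrightarrow> v = w"
    and v: "D_converges J le y v" and w: "D_converges J le y w"
  shows "v = w"
proof -
  obtain a b where a: "D_converges_reg a J le y v" and b: "D_converges_reg b J le y w"
    using v w by (auto simp: D_converges_def)
  have half: "u \<le> 2 *\<^sub>R t \<longleftrightarrow> (1/2) *\<^sub>R u \<le> t" "2 *\<^sub>R t \<le> u \<longleftrightarrow> t \<le> (1/2) *\<^sub>R u" for u t :: 'z
    using scaleR_left_mono[of u "2 *\<^sub>R t" "1/2"] scaleR_left_mono[of "(1/2) *\<^sub>R u" t 2]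
      scaleR_left_mono[of "2 *\<^sub>R t" u "1/2"] scaleR_left_mono[of t "(1/2) *\<^sub>R u" 2] by auto
  define c where "c n j = 2 *\<^sub>R (if even n then a (n div 2) j else b (n div 2) j)" for n j
  have glb: "isGlb UNIV (range f) 0 \<longleftrightarrow> (\<forall>j. 0 \<le> f j) \<and> (\<forall>l. (\<forall>j. l \<le> f j) \<longrightarrow> l \<le> 0)"
    for f :: "nat \<Rightarrow> 'z"
    by (auto simp: isGlb_def greatestP_def isLb_def setle_def setge_def)
  have lub: "isLub UNIV (range f) s \<longleftrightarrow> (\<forall>j. f j \<le> s) \<and> (\<forall>l. (\<forall>j. f j \<le> l) \<longrightarrow> s \<le> l)"
    for f :: "nat \<Rightarrow> 'z" and s
    by (auto simp: isLub_def leastP_def isUb_def setle_def setge_def)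
  have half0: "u \<le> 0" if "(1/2) *\<^sub>R u \<le> 0" for u :: 'z
    using half(1)[of u 0] that by simp
  have pos2: "0 \<le> 2 *\<^sub>R u" if "0 \<le> u" for u :: 'z
    using scaleR_left_mono[of 0 u 2] that by simp
  have Da: "D_sequence a" and Db: "D_sequence b"
    using a b by (auto simp: D_converges_reg_def)
  have Dc: "D_sequence c"
    unfolding D_sequence_def
  proof (intro conjI allI)
    show "c i (Suc j) \<le> c i j" for i j
      using Da Db by (auto simp: c_def D_sequence_def intro!: scaleR_left_mono)
    show "isGlb UNIV (range (c i)) 0" for i
    proof -
      define g where "g = (if even i then a (i div 2) else b (i div 2))"
      have g: "\<forall>j. 0 \<le> g j" "\<forall>l. (\<forall>j. l \<le> g j) \<longrightarrow> l \<le> 0"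
        using Da Db unfolding D_sequence_def glb g_def by simp_all
      have c: "c i j = 2 *\<^sub>R g j" for j
        by (simp add: c_def g_def)
      have "l \<le> 0" if l: "\<forall>j. l \<le> c i j" for l
      proof (rule half0)
        have "\<forall>j. (1/2) *\<^sub>R l \<le> g j"
          using l unfolding c half(1) .
        with g(2) show "(1/2) *\<^sub>R l \<le> 0" by blast
      qed
      moreover have "0 \<le> c i j" for j
        unfolding c using g(1) by (intro pos2) blast
      ultimately show ?thesis unfolding glb by blast
    qed
  qed
  have dist: "\<exists>s. isLub UNIV (range (\<lambda>j. c j (\<phi> j))) s \<and> \<bar>v - w\<bar> \<le> s" for \<phi>
  proof -
    obtain s i1 where s: "isLub UNIV (range (\<lambda>j. a j (\<phi> (2 * j)))) s"
      and i1: "i1 \<in> J" "\<And>i. i \<in> J \<Longrightarrow> le i1 i \<Longrightarrow> \<bar>y i - v\<bar> \<le> s"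
      using a unfolding D_converges_reg_def by (elim conjE allE[of _ "\<lambda>j. \<phi> (2 * j)"]) blast
    obtain t i2 where t: "isLub UNIV (range (\<lambda>j. b j (\<phi> (2 * j + 1)))) t"
      and i2: "i2 \<in> J" "\<And>i. i \<in> J \<Longrightarrow> le i2 i \<Longrightarrow> \<bar>y i - w\<bar> \<le> t"
      using b unfolding D_converges_reg_def by (elim conjE allE[of _ "\<lambda>j. \<phi> (2 * j + 1)"]) blast
    obtain k where k: "k \<in> J" "le i1 k" "le i2 k"
      using a i1(1) i2(1) unfolding D_converges_reg_def directed_set_def by meson
    let ?u = "sup (2 *\<^sub>R s) (2 *\<^sub>R t)"
    have "\<bar>v - w\<bar> \<le> \<bar>v - y k\<bar> + \<bar>y k - w\<bar>"
      using abs_triangle_ineq[of "v - y k" "y k - w"] by simp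
    also have "\<dots> \<le> s + t"
      using i1(2)[of k] i2(2)[of k] k by (intro add_mono) (simp_all add: abs_minus_commute)
    also have "\<dots> \<le> ?u"
    proof -
      have "s \<le> (1/2) *\<^sub>R ?u" "t \<le> (1/2) *\<^sub>R ?u"
        unfolding half(2)[symmetric] by simp_all
      then have "s + t \<le> (1/2) *\<^sub>R ?u + (1/2) *\<^sub>R ?u"
        by (rule add_mono)
      then show ?thesis
        by (simp flip: scaleR_add_left)
    qed
    finally have le_u: "\<bar>v - w\<bar> \<le> ?u" .
    have "isLub UNIV (range (\<lambda>j. c j (\<phi> j))) ?u"
      unfolding lub
    proof (intro conjI allI impI)
      fix n
      show "c n (\<phi> n) \<le> ?u"
      proof (cases "even n")
        case True
        then obtain m where "n = 2 * m" by (elim evenE)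
        then show ?thesis
          using s unfolding lub by (auto simp: c_def intro!: le_supI1 scaleR_left_mono)
      next
        case False
        then obtain m where "n = 2 * m + 1" by (elim oddE)
        then show ?thesis
          using t unfolding lub by (auto simp: c_def intro!: le_supI2 scaleR_left_mono)
      qed
    next
      fix l assume l: "\<forall>j. c j (\<phi> j) \<le> l"
      have "a j (\<phi> (2 * j)) \<le> (1/2) *\<^sub>R l" "b j (\<phi> (2 * j + 1)) \<le> (1/2) *\<^sub>R l" for j
        using l[rule_format, of "2 * j"] l[rule_format, of "2 * j + 1"]
        unfolding half(2)[symmetric] by (simp_all add: c_def)
      then show "?u \<le> l"
        using s t unfolding lub by (intro sup_least, unfold half(2)) blast+
    qed
    with le_u show ?thesis by blast
  qed
  have dir: "directed_set {undefined :: 'i} (\<lambda>_ _. True)"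
    by (auto simp: directed_set_def)
  have "D_converges_reg c {undefined :: 'i} (\<lambda>_ _. True) (\<lambda>_. v) w"
    using dir Dc dist by (auto simp: D_converges_reg_def)
  moreover have "D_converges_reg c {undefined :: 'i} (\<lambda>_ _. True) (\<lambda>_. v) v"
  proof -
    have "0 \<le> s" if "\<bar>v - w\<bar> \<le> s" for s
      using abs_ge_zero[of "v - w"] that by (rule order_trans)
    then show ?thesis
      using dir Dc dist by (auto simp: D_converges_reg_def) blast
  qed
  ultimately show ?thesis
    using unique unfolding D_converges_def by blast
qed

section \<open>Unconditional summability\<close>

definition D_sums_reg ::
  "(nat \<Rightarrow> nat \<Rightarrow> 'z::archimedean_riesz_space) \<Rightarrow> ('k \<Rightarrow> 'z) \<Rightarrow> 'k set \<Rightarrow> 'z \<Rightarrow> bool" where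
  "D_sums_reg a u K z \<longleftrightarrow> D_converges_reg a {J. J \<subseteq> K \<and> finite J} (\<subseteq>) (\<lambda>J. \<Sum>k\<in>J. u k) z"

definition D_sums :: "('k \<Rightarrow> 'z::archimedean_riesz_space) \<Rightarrow> 'k set \<Rightarrow> 'z \<Rightarrow> bool" where
  "D_sums u K z \<longleftrightarrow> D_converges {J. J \<subseteq> K \<and> finite J} (\<subseteq>) (\<lambda>J. \<Sum>k\<in>J. u k) z"

section \<open>Bilinear products\<close>

definition bilinear_product ::
  "('i, 'x::real_vector) net_conv \<Rightarrow> ('j, 'y::real_vector) net_conv
    \<Rightarrow> ('x \<Rightarrow> 'y \<Rightarrow> 'z::archimedean_riesz_space) \<Rightarrow> bool" where
  "bilinear_product \<eta>1 \<eta>2 B \<longleftrightarrow> bilinear B \<and>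
     (\<forall>I le x v y. \<eta>1 I le x v \<longrightarrow> D_converges I le (\<lambda>i. B (x i) y) (B v y)) \<and>
     (\<forall>I le y w x. \<eta>2 I le y w \<longrightarrow> D_converges I le (\<lambda>i. B x (y i)) (B x w))"

section \<open>Partitions and choice functions\<close>

definition paved_space :: "'w set \<Rightarrow> 'w set set \<Rightarrow> bool" where
  "paved_space \<Omega> H \<longleftrightarrow> \<Omega> \<noteq> {} \<and> H \<subseteq> Pow \<Omega> \<and> {} \<in> H"

definition partitions :: "'w set set \<Rightarrow> 'w set \<Rightarrow> 'w set set set" where
  "partitions H A = {P. partition_on A P \<and> countable P \<and> P \<subseteq> H}"

text \<open>The order \<open>P \<le> Q\<close> on \<open>partitions H A\<close> is \<^term>\<open>refines A Q P\<close>.\<close>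

definition choice_function :: "'w set \<Rightarrow> ('w set \<Rightarrow> 'w) \<Rightarrow> bool" where
  "choice_function \<Omega> \<delta> \<longleftrightarrow> (\<forall>\<alpha>. \<alpha> \<subseteq> \<Omega> \<longrightarrow> \<alpha> \<noteq> {} \<longrightarrow> \<delta> \<alpha> \<in> \<alpha>)"

section \<open>The \<open>S\<^sup>*\<close>-integral\<close>

text \<open>\<open>S P \<delta>\<close> is the sum of the series belonging to the partition \<open>P\<close> and the choice function \<open>\<delta>\<close>.\<close>

definition has_Sstar_integral ::
  "'w set \<Rightarrow> 'w set set \<Rightarrow> ('x \<Rightarrow> 'y \<Rightarrow> 'z::archimedean_riesz_space) \<Rightarrow> ('w set \<Rightarrow> 'y)
    \<Rightarrow> ('w \<Rightarrow> 'x) \<Rightarrow> 'w set \<Rightarrow> 'z \<Rightarrow> bool" where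
  "has_Sstar_integral \<Omega> H B \<mu> f A z \<longleftrightarrow>
     (\<exists>Ps\<in>partitions H A. \<exists>S.
        (\<forall>P\<in>partitions H A. \<forall>\<delta>. refines A P Ps \<longrightarrow> choice_function \<Omega> \<delta> \<longrightarrow>
           D_sums (\<lambda>\<alpha>. B (f (\<delta> \<alpha>)) (\<mu> \<alpha>)) P (S P \<delta>)) \<and>
        D_converges {(P, \<delta>). P \<in> partitions H A \<and> refines A P Ps \<and> choice_function \<Omega> \<delta>}
          (\<lambda>(P, _) (Q, _). refines A Q P) (\<lambda>(P, \<delta>). S P \<delta>) z)"

definition L_Sstar ::
  "'w set \<Rightarrow> 'w set set \<Rightarrow> ('x \<Rightarrow> 'y \<Rightarrow> 'z::archimedean_riesz_space) \<Rightarrow> ('w set \<Rightarrow> 'y)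
    \<Rightarrow> ('w \<Rightarrow> 'x) set" where
  "L_Sstar \<Omega> H B \<mu> = {f. \<forall>A\<in>insert \<Omega> H. \<exists>z. has_Sstar_integral \<Omega> H B \<mu> f A z}"

section \<open>The Sion integral\<close>

definition truncation :: "'w set \<Rightarrow> 'w set set \<Rightarrow> ('w set set \<Rightarrow> 'w set set) \<Rightarrow> bool" where
  "truncation \<Omega> H \<Delta> \<longleftrightarrow> (\<forall>P\<in>partitions H \<Omega>. finite (\<Delta> P) \<and> \<Delta> P \<subseteq> P)"

text \<open>\<open>Sion_le \<Omega> H (P, \<Delta>\<^sub>1) (Q, \<Delta>\<^sub>2)\<close> stands for \<open>(Q, \<Delta>\<^sub>2) \<ggreater> (P, \<Delta>\<^sub>1)\<close>.\<close>

definition Sion_le ::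
  "'w set \<Rightarrow> 'w set set \<Rightarrow> 'w set set \<times> ('w set set \<Rightarrow> 'w set set)
    \<Rightarrow> 'w set set \<times> ('w set set \<Rightarrow> 'w set set) \<Rightarrow> bool" where
  "Sion_le \<Omega> H = (\<lambda>(P, \<Delta>1) (Q, \<Delta>2). refines \<Omega> Q P \<and>
     (\<forall>M\<in>partitions H \<Omega>. refines \<Omega> M Q \<longrightarrow> \<Delta>1 M \<subseteq> \<Delta>2 M))"

definition Sion_integrable ::
  "'w set \<Rightarrow> 'w set set \<Rightarrow> ('x \<Rightarrow> 'y \<Rightarrow> 'z::archimedean_riesz_space) \<Rightarrow> ('w set \<Rightarrow> 'y)
    \<Rightarrow> ('w \<Rightarrow> 'x) \<Rightarrow> bool" where
  "Sion_integrable \<Omega> H B \<mu> f \<longleftrightarrow>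
     (\<exists>z. D_converges
        {(P, \<delta>, \<Delta>). P \<in> partitions H \<Omega> \<and> choice_function \<Omega> \<delta> \<and> truncation \<Omega> H \<Delta>}
        (\<lambda>(P, _, \<Delta>1) (Q, _, \<Delta>2). Sion_le \<Omega> H (P, \<Delta>1) (Q, \<Delta>2))
        (\<lambda>(P, \<delta>, \<Delta>). \<Sum>\<alpha>\<in>\<Delta> P. B (f (\<delta> \<alpha>)) (\<mu> \<alpha>)) z)"

end

theory Submission
  imports Defs
begin

text \<open>
  A Sion sum over \<open>\<Delta> P\<close> is a finite partial sum of the series over \<open>P\<close>, and the full sums
  \<open>S P \<delta>\<close> converge to the \<open>S\<^sup>*\<close>-integral \<open>z\<close>. It therefore suffices to bound the
  remainder \<open>\<bar>(\<Sum>\<alpha>\<in>\<Delta> P. B (f (\<delta> \<alpha>)) (\<mu> \<alpha>)) - S P \<delta>\<bar>\<close> with the given regulator.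
  The difficulty is that a truncation chooses its finite subfamily before \<open>\<delta>\<close> is known, whereas
  unconditional convergence provides, for a given \<open>\<phi>\<close>, a finite subfamily that depends on \<open>\<delta>\<close>.

  A gliding hump argument (\<open>uniform_tails\<close>) removes this dependence. If no finite subfamily
  served all choices of points, there would be disjoint finite blocks of \<open>P\<close>, each with a choice
  function whose sum over that block is too large. A choice function can be prescribed on each
  member of \<open>P\<close> separately, so these combine into one choice function with large sums over
  infinitely many disjoint blocks, contrary to the Cauchy condition for its series. It is
  essential here that the regulator is common to all \<open>\<delta>\<close>: the same element
  \<open>\<Or>j. a j (\<phi> j)\<close> says what \<open>too large\<close> means for all blocks.

  With such a subfamily taken as \<open>\<Delta>\<^sub>1 P\<close> for each \<open>P\<close>, the remainder is at most three times
  \<open>\<Or>j. a j (\<phi> j)\<close> as soon as \<open>\<Delta> P\<close> contains \<open>\<Delta>\<^sub>1 P\<close> (\<open>uniform_remainder\<close>). The regulator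
  of the \<open>S\<^sup>*\<close>-integral and the (tripled) common regulator are then merged into one
  (\<open>D_converges_two_regulators\<close>).
\<close>

section \<open>Combining regulators\<close>

lemma isLub_range_iff:
  fixes f :: "'k \<Rightarrow> 'z::order"
  shows "isLub UNIV (range f) s \<longleftrightarrow> (\<forall>j. f j \<le> s) \<and> (\<forall>l. (\<forall>j. f j \<le> l) \<longrightarrow> s \<le> l)"
  by (auto simp: isLub_def leastP_def isUb_def setle_def setge_def)

lemma isGlb_range_iff:
  fixes f :: "'k \<Rightarrow> 'z::order"
  shows "isGlb UNIV (range f) s \<longleftrightarrow> (\<forall>j. s \<le> f j) \<and> (\<forall>l. (\<forall>j. l \<le> f j) \<longrightarrow> l \<le> s)"
  by (auto simp: isGlb_def greatestP_def isLb_def setle_def setge_def)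

lemma isLub_range_unique:
  fixes f :: "'k \<Rightarrow> 'z::order"
  assumes "isLub UNIV (range f) s" "isLub UNIV (range f) t"
  shows "s = t"
  using assms unfolding isLub_range_iff by (blast intro: antisym)

lemma isLub_range_scaleR:
  fixes f :: "'k \<Rightarrow> 'z::ordered_real_vector"
  assumes "0 < c" and "isLub UNIV (range f) s"
  shows "isLub UNIV (range (\<lambda>j. c *\<^sub>R f j)) (c *\<^sub>R s)"
  using assms by (auto simp: isLub_range_iff scaleR_left_mono simp flip: pos_le_divideR_eq)

lemma D_sequence_scaleR:
  assumes c: "0 < c" and a: "D_sequence a"
  shows "D_sequence (\<lambda>i j. c *\<^sub>R a i j)"
proof -
  have "l \<le> 0" if "\<forall>j. l \<le> c *\<^sub>R a i j" for l i
  proof -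
    have "\<forall>j. l /\<^sub>R c \<le> a i j"
      using that c by (simp add: pos_divideR_le_eq)
    then have "l /\<^sub>R c \<le> 0"
      using a unfolding D_sequence_def isGlb_range_iff by blast
    then show ?thesis
      using c by (simp add: pos_divideR_le_eq)
  qed
  moreover have "0 \<le> c *\<^sub>R a i j" "c *\<^sub>R a i (Suc j) \<le> c *\<^sub>R a i j" for i j
    using a c by (auto simp: D_sequence_def isGlb_range_iff
        intro!: scaleR_nonneg_nonneg scaleR_left_mono)
  ultimately show ?thesis
    by (auto simp: D_sequence_def isGlb_range_iff)
qed

definition interleave :: "(nat \<Rightarrow> 'c) \<Rightarrow> (nat \<Rightarrow> 'c) \<Rightarrow> nat \<Rightarrow> 'c" where
  "interleave a b n = (if even n then a (n div 2) else b (n div 2))"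

lemma D_sequence_interleave:
  assumes "D_sequence a" and "D_sequence b"
  shows "D_sequence (interleave a b)"
  using assms by (auto simp: D_sequence_def interleave_def)

lemma isLub_interleave:
  fixes a b :: "nat \<Rightarrow> nat \<Rightarrow> 'z::lattice"
  assumes s: "isLub UNIV (range (\<lambda>j. a j (\<phi> (2 * j)))) s"
    and t: "isLub UNIV (range (\<lambda>j. b j (\<phi> (2 * j + 1)))) t"
  shows "isLub UNIV (range (\<lambda>n. interleave a b n (\<phi> n))) (sup s t)"
  unfolding isLub_range_iff
proof (intro conjI allI impI)
  show "interleave a b n (\<phi> n) \<le> sup s t" for n
  proof (cases "even n")
    case True
    then obtain m where "n = 2 * m" by (elim evenE)
    then show ?thesis
      using s by (auto simp: interleave_def isLub_range_iff intro: le_supI1)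
  next
    case False
    then obtain m where "n = 2 * m + 1" by (elim oddE)
    then show ?thesis
      using t by (auto simp: interleave_def isLub_range_iff intro: le_supI2)
  qed
  fix l assume l: "\<forall>n. interleave a b n (\<phi> n) \<le> l"
  have "a j (\<phi> (2 * j)) \<le> l" "b j (\<phi> (2 * j + 1)) \<le> l" for j
    using l[rule_format, of "2 * j"] l[rule_format, of "2 * j + 1"]
    by (simp_all add: interleave_def)
  with s t show "sup s t \<le> l"
    unfolding isLub_range_iff by (blast intro: sup_least)
qed

lemma add_le_sup_twice:
  fixes s t :: "'z::archimedean_riesz_space"
  shows "s + t \<le> sup (2 *\<^sub>R s) (2 *\<^sub>R t)" (is "_ \<le> ?u")
proof -
  have "s \<le> ?u /\<^sub>R 2" "t \<le> ?u /\<^sub>R 2"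
    by (rule pos_le_divideR_eq[THEN iffD2]; simp)+
  then have "s + t \<le> ?u /\<^sub>R 2 + ?u /\<^sub>R 2"
    by (rule add_mono)
  also have "\<dots> = ?u"
    by (simp flip: scaleR_add_left)
  finally show ?thesis .
qed

text \<open>
  The merged regulator has the rows of \<open>2a\<close> and \<open>2b\<close> in alternation: the supremum along a
  diagonal \<open>\<phi>\<close> is then the join of a diagonal supremum of \<open>2a\<close> and one of \<open>2b\<close>, and a
  join \<open>sup (2s) (2t)\<close> dominates \<open>s + t\<close>.
\<close>

lemma D_converges_two_regulators:
  assumes dir: "directed_set I le" and a: "D_sequence a" and b: "D_sequence b"
    and bound: "\<And>\<phi> \<psi> :: nat \<Rightarrow> nat. \<exists>s t. isLub UNIV (range (\<lambda>j. a j (\<phi> j))) s \<and>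
        isLub UNIV (range (\<lambda>j. b j (\<psi> j))) t \<and>
        (\<exists>i0\<in>I. \<forall>i\<in>I. le i0 i \<longrightarrow> \<bar>x i - v\<bar> \<le> s + t)"
  shows "D_converges I le x v"
proof -
  define c where "c = interleave (\<lambda>i j. 2 *\<^sub>R a i j) (\<lambda>i j. 2 *\<^sub>R b i j)"
  have "D_sequence c"
    unfolding c_def using a b by (intro D_sequence_interleave D_sequence_scaleR) simp_all
  moreover have "\<exists>s. isLub UNIV (range (\<lambda>j. c j (\<phi> j))) s \<and>
      (\<exists>i0\<in>I. \<forall>i\<in>I. le i0 i \<longrightarrow> \<bar>x i - v\<bar> \<le> s)" for \<phi>
  proof -
    obtain s t where s: "isLub UNIV (range (\<lambda>j. a j (\<phi> (2 * j)))) s"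
      and t: "isLub UNIV (range (\<lambda>j. b j (\<phi> (2 * j + 1)))) t"
      and ev: "\<exists>i0\<in>I. \<forall>i\<in>I. le i0 i \<longrightarrow> \<bar>x i - v\<bar> \<le> s + t"
      using bound[of "\<lambda>j. \<phi> (2 * j)" "\<lambda>j. \<phi> (2 * j + 1)"] by blast
    have "isLub UNIV (range (\<lambda>j. c j (\<phi> j))) (sup (2 *\<^sub>R s) (2 *\<^sub>R t))"
      unfolding c_def by (intro isLub_interleave isLub_range_scaleR s t) simp_all
    then show ?thesis
      using ev add_le_sup_twice[of s t] by (meson order_trans)
  qed
  ultimately show ?thesis
    using dir unfolding D_converges_def D_converges_reg_def by blast
qed

section \<open>Remainders uniform in the choice of points\<close>

text \<open>
  The Cauchy condition: a sum over a finite set off \<open>F\<close> is the difference of two sums over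
  sets that contain \<open>F\<close>.
\<close>

lemma D_sums_reg_tails:
  assumes sums: "D_sums_reg a u K z" and s: "isLub UNIV (range (\<lambda>j. a j (\<phi> j))) s"
  shows "\<exists>F\<subseteq>K. finite F \<and> (\<forall>J\<subseteq>K. finite J \<longrightarrow> F \<subseteq> J \<longrightarrow> \<bar>sum u J - z\<bar> \<le> s) \<and>
           (\<forall>J\<subseteq>K. finite J \<longrightarrow> J \<inter> F = {} \<longrightarrow> \<bar>sum u J\<bar> \<le> 2 *\<^sub>R s)"
proof -
  obtain s' F where s': "isLub UNIV (range (\<lambda>j. a j (\<phi> j))) s'"
    and F: "F \<subseteq> K" "finite F"
    and near': "\<And>J. J \<subseteq> K \<Longrightarrow> finite J \<Longrightarrow> F \<subseteq> J \<Longrightarrow> \<bar>sum u J - z\<bar> \<le> s'"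
    using sums unfolding D_sums_reg_def D_converges_reg_def
    by (elim conjE allE[of _ \<phi>] exE bexE) auto
  have near: "\<bar>sum u J - z\<bar> \<le> s" if "J \<subseteq> K" "finite J" "F \<subseteq> J" for J
    using near'[OF that] isLub_range_unique[OF s' s] by simp
  have "\<bar>sum u J\<bar> \<le> 2 *\<^sub>R s" if J: "J \<subseteq> K" "finite J" "J \<inter> F = {}" for J
  proof -
    have "(sum u (J \<union> F) - z) + (z - sum u F) = sum u J"
      using sum.union_disjoint[OF J(2) F(2) J(3), of u] by simp
    then have "\<bar>sum u J\<bar> \<le> \<bar>sum u (J \<union> F) - z\<bar> + \<bar>z - sum u F\<bar>"
      using abs_triangle_ineq[of "sum u (J \<union> F) - z" "z - sum u F"] by simp
    also have "\<dots> \<le> s + s"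
      using near[of "J \<union> F"] near[of F] J F by (intro add_mono) (auto simp: abs_minus_commute)
    finally show ?thesis by (simp add: scaleR_2)
  qed
  with near F show ?thesis by blast
qed

text \<open>
  The gliding hump. If each finite \<open>F\<close> admitted a bad finite block disjoint from it, picking
  bad blocks one after another and following on each block the choice that makes it bad would
  give a choice with infinitely many disjoint bad blocks; only finitely many of them can meet a
  given finite set.
\<close>

lemma uniform_tails:
  fixes u :: "'k \<Rightarrow> 'c \<Rightarrow> 'z::comm_monoid_add"
  assumes tails: "\<And>\<delta>. \<delta> \<in> Pi A C \<Longrightarrow>
      \<exists>F\<subseteq>K. finite F \<and> (\<forall>J\<subseteq>K. finite J \<longrightarrow> J \<inter> F = {} \<longrightarrow> R (\<Sum>k\<in>J. u k (\<delta> k)))"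
  shows "\<exists>F\<subseteq>K. finite F \<and>
      (\<forall>\<delta>\<in>Pi A C. \<forall>J\<subseteq>K. finite J \<longrightarrow> J \<inter> F = {} \<longrightarrow> R (\<Sum>k\<in>J. u k (\<delta> k)))"
  (is ?uniform)
proof (rule ccontr)
  assume contra: "\<not> ?uniform"
  define good where "good \<delta> J \<longleftrightarrow> R (\<Sum>k\<in>J. u k (\<delta> k))" for \<delta> J
  have "\<exists>\<delta> J. \<delta> \<in> Pi A C \<and> J \<subseteq> K \<and> finite J \<and> J \<inter> F = {} \<and> \<not> good \<delta> J"
    if F: "F \<subseteq> K" "finite F" for F
    using contra F unfolding good_def[symmetric] by meson
  then obtain d B where dB: "\<And>F. F \<subseteq> K \<Longrightarrow> finite F \<Longrightarrow> d F \<in> Pi A C \<and> B F \<subseteq> K \<and>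
      finite (B F) \<and> B F \<inter> F = {} \<and> \<not> good (d F) (B F)"
    by metis
  define U where "U = rec_nat {} (\<lambda>_ F. F \<union> B F)"
  have U_simps: "U 0 = {}" "U (Suc n) = U n \<union> B (U n)" for n
    by (simp_all add: U_def)
  have U: "U n \<subseteq> K \<and> finite (U n)" for n
    by (induction n) (use dB in \<open>auto simp: U_simps\<close>)
  note bad = dB[OF conjunct1[OF U] conjunct2[OF U]]
  have U_mono: "U m \<subseteq> U n" if "m \<le> n" for m n
    using that by (rule lift_Suc_mono_le[of U, rotated]) (simp add: U_simps)
  have block_disj: "m = n" if "k \<in> B (U m)" "k \<in> B (U n)" for k m n
  proof (rule ccontr)
    have "False" if "m < n" "k \<in> B (U m)" "k \<in> B (U n)" for m n
      using U_mono[of "Suc m" n] that bad[of n] by (auto simp: U_simps)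
    moreover assume "m \<noteq> n"
    ultimately show False
      using that by (metis nat_neq_iff)
  qed
  \<comment> \<open>Off the blocks any admissible value will do; the first of the bad choices supplies one.\<close>
  define \<delta> where
    "\<delta> k = (if \<exists>n. k \<in> B (U n) then d (U (THE n. k \<in> B (U n))) k else d (U 0) k)" for k
  have \<delta>_eq: "\<delta> k = d (U n) k" if "k \<in> B (U n)" for k n
  proof -
    have "(THE n. k \<in> B (U n)) = n"
      using that block_disj by blast
    then show ?thesis using that by (auto simp: \<delta>_def)
  qed
  have "\<delta> \<in> Pi A C"
    using bad by (auto simp: \<delta>_def Pi_iff)
  then obtain F where F: "finite F"
    and F_good: "\<And>J. J \<subseteq> K \<Longrightarrow> finite J \<Longrightarrow> J \<inter> F = {} \<Longrightarrow> good \<delta> J"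
    using tails unfolding good_def[symmetric] by meson
  have "\<exists>n. B (U n) \<inter> F = {}"
  proof (rule ccontr)
    assume "\<not> ?thesis"
    then have "\<forall>n. \<exists>k. k \<in> B (U n) \<inter> F"
      by auto
    then obtain p where p: "p n \<in> B (U n) \<inter> F" for n
      by (elim choice[THEN exE]) blast
    then have "inj p"
      by (intro injI) (metis IntD1 block_disj)
    moreover have "finite (range p)"
      using p F by (auto intro: finite_subset)
    ultimately show False
      using finite_imageD infinite_UNIV_nat by blast
  qed
  then obtain n where n: "B (U n) \<inter> F = {}" ..
  have "(\<Sum>k\<in>B (U n). u k (\<delta> k)) = (\<Sum>k\<in>B (U n). u k (d (U n) k))"
    by (intro sum.cong refl) (simp add: \<delta>_eq)
  then have "good \<delta> (B (U n)) \<longleftrightarrow> good (d (U n)) (B (U n))"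
    by (simp add: good_def)
  then show False
    using F_good[of "B (U n)"] n bad[of n] by simp
qed

text \<open>
  A set \<open>J\<close> that contains the common \<open>F\<close> need not be large enough for a given \<open>\<delta>\<close>; enlarging
  it by the finite set belonging to \<open>\<delta>\<close> costs a sum off \<open>F\<close>, at most \<open>2s\<close>, and leaves an
  error of at most \<open>s\<close>.
\<close>

lemma uniform_remainder:
  assumes sums: "\<And>\<delta>. \<delta> \<in> Pi A C \<Longrightarrow> D_sums_reg a (\<lambda>k. u k (\<delta> k)) K (S \<delta>)"
    and s: "isLub UNIV (range (\<lambda>j. a j (\<phi> j))) s"
  shows "\<exists>F\<subseteq>K. finite F \<and> (\<forall>\<delta>\<in>Pi A C. \<forall>J\<subseteq>K. finite J \<longrightarrow> F \<subseteq> J \<longrightarrow>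
           \<bar>(\<Sum>k\<in>J. u k (\<delta> k)) - S \<delta>\<bar> \<le> 3 *\<^sub>R s)"
proof -
  have "\<exists>F\<subseteq>K. finite F \<and>
      (\<forall>\<delta>\<in>Pi A C. \<forall>J\<subseteq>K. finite J \<longrightarrow> J \<inter> F = {} \<longrightarrow> \<bar>\<Sum>k\<in>J. u k (\<delta> k)\<bar> \<le> 2 *\<^sub>R s)"
  proof (rule uniform_tails)
    fix \<delta> assume "\<delta> \<in> Pi A C"
    from D_sums_reg_tails[OF sums[OF this] s]
    show "\<exists>F\<subseteq>K. finite F \<and>
        (\<forall>J\<subseteq>K. finite J \<longrightarrow> J \<inter> F = {} \<longrightarrow> \<bar>\<Sum>k\<in>J. u k (\<delta> k)\<bar> \<le> 2 *\<^sub>R s)"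
      by (elim exE conjE) (intro exI conjI)
  qed
  then obtain F where F: "F \<subseteq> K" "finite F" and tail: "\<And>\<delta> J. \<delta> \<in> Pi A C \<Longrightarrow> J \<subseteq> K \<Longrightarrow>
      finite J \<Longrightarrow> J \<inter> F = {} \<Longrightarrow> \<bar>\<Sum>k\<in>J. u k (\<delta> k)\<bar> \<le> 2 *\<^sub>R s"
    by (elim exE conjE) auto
  have "\<bar>(\<Sum>k\<in>J. u k (\<delta> k)) - S \<delta>\<bar> \<le> 3 *\<^sub>R s"
    if \<delta>: "\<delta> \<in> Pi A C" and J: "J \<subseteq> K" "finite J" "F \<subseteq> J" for \<delta> J
  proof -
    let ?sum = "\<lambda>J. \<Sum>k\<in>J. u k (\<delta> k)"
    obtain G where G: "G \<subseteq> K" "finite G"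
      and near: "\<And>J. J \<subseteq> K \<Longrightarrow> finite J \<Longrightarrow> G \<subseteq> J \<Longrightarrow> \<bar>?sum J - S \<delta>\<bar> \<le> s"
      using D_sums_reg_tails[OF sums[OF \<delta>] s] by (elim exE conjE) auto
    have "?sum (J \<union> G) = ?sum J + ?sum (G - J)"
      using sum.union_disjoint[of J "G - J"] J(2) G(2) by simp
    then have eq: "(?sum (J \<union> G) - S \<delta>) + - ?sum (G - J) = ?sum J - S \<delta>"
      by simp
    have "\<bar>?sum J - S \<delta>\<bar> \<le> \<bar>?sum (J \<union> G) - S \<delta>\<bar> + \<bar>- ?sum (G - J)\<bar>"
      using abs_triangle_ineq[of "?sum (J \<union> G) - S \<delta>" "- ?sum (G - J)"] unfolding eq .
    also have "\<dots> \<le> s + 2 *\<^sub>R s"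
      using near[of "J \<union> G"] tail[OF \<delta>, of "G - J"] J G by (intro add_mono) auto
    also have "\<dots> = 3 *\<^sub>R s"
      using scaleR_add_left[of 1 2 s] by simp
    finally show ?thesis .
  qed
  with F show ?thesis by (intro exI[of _ F] conjI ballI allI impI)
qed

section \<open>The directed set of the Sion integral\<close>

text \<open>
  Values of a choice function at different sets are unrelated, so choice functions can be
  pieced together; membership in a product expresses this.
\<close>

lemma choice_function_eq_Pi: "choice_function \<Omega> \<delta> \<longleftrightarrow> \<delta> \<in> Pi (Pow \<Omega> - {{}}) (\<lambda>\<alpha>. \<alpha>)"
  by (auto simp: choice_function_def Pi_iff)

lemma choice_function_exists: "\<exists>\<delta>. choice_function \<Omega> \<delta>"
  unfolding choice_function_def by (rule exI[of _ "\<lambda>\<alpha>. SOME w. w \<in> \<alpha>"]) (simp add: some_in_eq)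

lemma refines_refl_partitions: "P \<in> partitions H A \<Longrightarrow> refines A P P"
  by (simp add: partitions_def refines_refl)

text \<open>
  Above \<open>(P\<^sub>1, \<Delta>\<^sub>1)\<close> and \<open>(P\<^sub>2, \<Delta>\<^sub>2)\<close> lies any common refinement with the pointwise union of the
  truncations.
\<close>

lemma directed_Sion_index:
  assumes dir: "directed_set (partitions H \<Omega>) (\<lambda>P Q. refines \<Omega> Q P)"
  shows "directed_set {(P, \<delta>, \<Delta>). P \<in> partitions H \<Omega> \<and> choice_function \<Omega> \<delta> \<and> truncation \<Omega> H \<Delta>}
    (\<lambda>(P, _, \<Delta>1) (Q, _, \<Delta>2). Sion_le \<Omega> H (P, \<Delta>1) (Q, \<Delta>2))"
  (is "directed_set ?I ?le")
proof -
  obtain P0 where P0: "P0 \<in> partitions H \<Omega>"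
    using dir by (auto simp: directed_set_def)
  obtain \<delta>0 where \<delta>0: "choice_function \<Omega> \<delta>0"
    using choice_function_exists by blast
  have trans: "refines \<Omega> R P" if "refines \<Omega> Q P" "refines \<Omega> R Q" for P Q R
    using that refines_trans by blast
  have "(P0, \<delta>0, \<lambda>_. {}) \<in> ?I"
    using P0 \<delta>0 by (simp add: truncation_def)
  then have "?I \<noteq> {}" by blast
  moreover have "?le i i" if "i \<in> ?I" for i
    using that by (auto simp: Sion_le_def refines_refl_partitions)
  moreover have "?le i k" if "i \<in> ?I" "j \<in> ?I" "k \<in> ?I" and le: "?le i j" "?le j k" for i j k
  proof -
    obtain P \<delta>1 \<Delta>1 Q \<delta>2 \<Delta>2 R \<delta>3 \<Delta>3
      where eq: "i = (P, \<delta>1, \<Delta>1)" "j = (Q, \<delta>2, \<Delta>2)" "k = (R, \<delta>3, \<Delta>3)"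
      by (metis prod_cases3)
    have PQ: "refines \<Omega> Q P" and QR: "refines \<Omega> R Q"
      and \<Delta>12: "\<And>M. M \<in> partitions H \<Omega> \<Longrightarrow> refines \<Omega> M Q \<Longrightarrow> \<Delta>1 M \<subseteq> \<Delta>2 M"
      and \<Delta>23: "\<And>M. M \<in> partitions H \<Omega> \<Longrightarrow> refines \<Omega> M R \<Longrightarrow> \<Delta>2 M \<subseteq> \<Delta>3 M"
      using le by (simp_all add: eq Sion_le_def)
    have "\<Delta>1 M \<subseteq> \<Delta>3 M" if M: "M \<in> partitions H \<Omega>" "refines \<Omega> M R" for M
      using \<Delta>12[OF M(1) trans[OF QR M(2)]] \<Delta>23[OF M] by (rule subset_trans)
    with trans[OF PQ QR] show ?thesis
      by (simp add: eq Sion_le_def)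
  qed
  moreover have "\<exists>k\<in>?I. ?le i k \<and> ?le j k" if "i \<in> ?I" "j \<in> ?I" for i j
  proof -
    obtain P \<delta>1 \<Delta>1 Q \<delta>2 \<Delta>2 where eq: "i = (P, \<delta>1, \<Delta>1)" "j = (Q, \<delta>2, \<Delta>2)"
      by (metis prod_cases3)
    have "P \<in> partitions H \<Omega>" "Q \<in> partitions H \<Omega>"
      using that by (auto simp: eq)
    then obtain R where R: "R \<in> partitions H \<Omega>" "refines \<Omega> R P" "refines \<Omega> R Q"
      using dir unfolding directed_set_def by meson
    have "(R, \<delta>1, \<lambda>M. \<Delta>1 M \<union> \<Delta>2 M) \<in> ?I"
      using that R by (auto simp: eq truncation_def)
    moreover have "?le i (R, \<delta>1, \<lambda>M. \<Delta>1 M \<union> \<Delta>2 M)" "?le j (R, \<delta>1, \<lambda>M. \<Delta>1 M \<union> \<Delta>2 M)"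
      using R by (auto simp: eq Sion_le_def)
    ultimately show ?thesis by (intro bexI conjI)
  qed
  ultimately show ?thesis
    unfolding directed_set_def by (intro conjI ballI impI)
qed

section \<open>Sion integrability\<close>

text \<open>
  The hypothesis on the series gives some sum with the common regulator, the
  \<open>S\<^sup>*\<close>-integral gives the sum \<open>S P \<delta>\<close> with some regulator. Uniqueness of \<open>(D)\<close>-limits
  identifies the two sums, so that \<open>S P \<delta>\<close> has the common regulator.
\<close>

theorem proposition3p9:
  fixes \<Omega> :: "'w set" and H :: "'w set set"
    and \<eta>1 :: "('i, 'x::real_vector) net_conv"
    and \<eta>2 :: "('j, 'y::real_vector) net_conv"
    and B :: "'x \<Rightarrow> 'y \<Rightarrow> 'z::archimedean_riesz_space"
    and \<mu> :: "'w set \<Rightarrow> 'y" and f :: "'w \<Rightarrow> 'x"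
  assumes "paved_space \<Omega> H"
    and "ring_of_sets \<Omega> H"
    and "\<exists>C\<subseteq>H. countable C \<and> disjoint C \<and> \<Union>C = \<Omega>"
    and "\<forall>A\<in>insert \<Omega> H. directed_set (partitions H A) (\<lambda>P Q. refines A Q P)"
    and "convergence_vector_space \<eta>1"
    and "convergence_vector_space \<eta>2"
    and "convergence_vector_space (D_converges :: ('k, 'z) net_conv)"
    and "bilinear_product \<eta>1 \<eta>2 B"
    and "f \<in> L_Sstar \<Omega> H B \<mu>"
    and "\<exists>P0\<in>partitions H \<Omega>. \<exists>a. D_sequence a \<and>
           (\<forall>P\<in>partitions H \<Omega>. \<forall>\<delta>. refines \<Omega> P P0 \<longrightarrow> choice_function \<Omega> \<delta> \<longrightarrow>
              (\<exists>s. D_sums_reg a (\<lambda>\<alpha>. B (f (\<delta> \<alpha>)) (\<mu> \<alpha>)) P s))"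
  shows "Sion_integrable \<Omega> H B \<mu> f"
proof -
  let ?P = "partitions H \<Omega>" and ?u = "\<lambda>\<alpha> w. B (f w) (\<mu> \<alpha>)"
  let ?I = "{(P, \<delta>, \<Delta>). P \<in> ?P \<and> choice_function \<Omega> \<delta> \<and> truncation \<Omega> H \<Delta>}"
  let ?le = "\<lambda>(P, _, \<Delta>1) (Q, _, \<Delta>2). Sion_le \<Omega> H (P, \<Delta>1) (Q, \<Delta>2)"
  let ?x = "\<lambda>(P, \<delta>, \<Delta>). \<Sum>\<alpha>\<in>\<Delta> P. ?u \<alpha> (\<delta> \<alpha>)"
  have dir: "directed_set ?P (\<lambda>P Q. refines \<Omega> Q P)"
    using assms(4) by blast
  \<comment> \<open>Limits are assumed unique for nets over one index type; here the nets have finite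
      families of sets as indices.\<close>
  have unique: "v = w" if "D_converges J le y v" "D_converges J le y w"
    for J :: "'w set set set" and le and y :: "'w set set \<Rightarrow> 'z" and v w
    using D_converges_unique_transfer[where 'i = 'k, OF _ that] assms(7)
    unfolding convergence_vector_space_def by blast
  obtain z where "has_Sstar_integral \<Omega> H B \<mu> f \<Omega> z"
    using assms(9) unfolding L_Sstar_def by blast
  then obtain Ps S b where Ps: "Ps \<in> ?P"
    and S: "\<And>P \<delta>. P \<in> ?P \<Longrightarrow> refines \<Omega> P Ps \<Longrightarrow> choice_function \<Omega> \<delta> \<Longrightarrow>
        D_sums (\<lambda>\<alpha>. ?u \<alpha> (\<delta> \<alpha>)) P (S P \<delta>)"
    and b: "D_converges_reg b {(P, \<delta>). P \<in> ?P \<and> refines \<Omega> P Ps \<and> choice_function \<Omega> \<delta>}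
        (\<lambda>(P, _) (Q, _). refines \<Omega> Q P) (\<lambda>(P, \<delta>). S P \<delta>) z"
    unfolding has_Sstar_integral_def D_converges_def by blast
  have Db: "D_sequence b"
    using b by (simp add: D_converges_reg_def)
  obtain P0 a where P0: "P0 \<in> ?P" and Da: "D_sequence a"
    and a: "\<And>P \<delta>. P \<in> ?P \<Longrightarrow> refines \<Omega> P P0 \<Longrightarrow> choice_function \<Omega> \<delta> \<Longrightarrow>
        \<exists>s. D_sums_reg a (\<lambda>\<alpha>. ?u \<alpha> (\<delta> \<alpha>)) P s"
    using assms(10) by blast
  have S_reg: "D_sums_reg a (\<lambda>\<alpha>. ?u \<alpha> (\<delta> \<alpha>)) P (S P \<delta>)"
    if P: "P \<in> ?P" "refines \<Omega> P Ps" "refines \<Omega> P P0" and \<delta>: "choice_function \<Omega> \<delta>" for P \<delta>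
  proof -
    obtain s where s: "D_sums_reg a (\<lambda>\<alpha>. ?u \<alpha> (\<delta> \<alpha>)) P s"
      using a P \<delta> by blast
    then have "D_sums (\<lambda>\<alpha>. ?u \<alpha> (\<delta> \<alpha>)) P s"
      unfolding D_sums_def D_sums_reg_def D_converges_def by blast
    then have "s = S P \<delta>"
      using S[OF P(1,2) \<delta>] unfolding D_sums_def by (rule unique)
    with s show ?thesis by simp
  qed
  have bound: "\<exists>s t. isLub UNIV (range (\<lambda>j. 3 *\<^sub>R a j (\<phi> j))) s \<and>
      isLub UNIV (range (\<lambda>j. b j (\<psi> j))) t \<and>
      (\<exists>i0\<in>?I. \<forall>i\<in>?I. ?le i0 i \<longrightarrow> \<bar>?x i - z\<bar> \<le> s + t)" for \<phi> \<psi> :: "nat \<Rightarrow> nat"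
  proof -
    obtain t i1 where t: "isLub UNIV (range (\<lambda>j. b j (\<psi> j))) t"
      and i1: "i1 \<in> {(P, \<delta>). P \<in> ?P \<and> refines \<Omega> P Ps \<and> choice_function \<Omega> \<delta>}"
      and t_bound: "\<forall>i\<in>{(P, \<delta>). P \<in> ?P \<and> refines \<Omega> P Ps \<and> choice_function \<Omega> \<delta>}.
        (case i1 of (P, _) \<Rightarrow> \<lambda>(Q, _). refines \<Omega> Q P) i \<longrightarrow> \<bar>(case i of (P, \<delta>) \<Rightarrow> S P \<delta>) - z\<bar> \<le> t"
      using b unfolding D_converges_reg_def by (elim conjE allE[of _ \<psi>]) blast
    obtain P1 \<delta>1 where i1_eq: "i1 = (P1, \<delta>1)"
      by (cases i1)
    have P1: "P1 \<in> ?P" "refines \<Omega> P1 Ps" and \<delta>1: "choice_function \<Omega> \<delta>1"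
      using i1 by (auto simp: i1_eq)
    have near_z: "\<bar>S P \<delta> - z\<bar> \<le> t" if "P \<in> ?P" "refines \<Omega> P P1" "choice_function \<Omega> \<delta>" for P \<delta>
      using bspec[OF t_bound, of "(P, \<delta>)"] that refines_trans[OF that(2) P1(2)]
      by (auto simp: i1_eq)
    obtain P2 where P2: "P2 \<in> ?P" "refines \<Omega> P2 P1" "refines \<Omega> P2 P0"
      using dir P1(1) P0 unfolding directed_set_def by meson
    have below: "refines \<Omega> P P1" "refines \<Omega> P Ps" "refines \<Omega> P P0" if "refines \<Omega> P P2" for P
      using that P1(2) P2(2,3) by (meson refines_trans)+
    obtain s where s: "isLub UNIV (range (\<lambda>j. a j (\<phi> j))) s"
      using S_reg[OF P2(1) below(2,3) \<delta>1] refines_refl_partitions[OF P2(1)]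
      unfolding D_sums_reg_def D_converges_reg_def by meson
    define close where "close P F \<longleftrightarrow>
        (\<forall>\<delta>\<in>Pi (Pow \<Omega> - {{}}) (\<lambda>\<alpha>. \<alpha>). \<forall>J\<subseteq>P. finite J \<longrightarrow> F \<subseteq> J \<longrightarrow>
          \<bar>(\<Sum>\<alpha>\<in>J. ?u \<alpha> (\<delta> \<alpha>)) - S P \<delta>\<bar> \<le> 3 *\<^sub>R s)" for P F
    have "\<exists>F\<subseteq>P. finite F \<and> close P F" if P: "P \<in> ?P" "refines \<Omega> P P2" for P
      unfolding close_def
    proof (rule uniform_remainder[where a = a and \<phi> = \<phi> and u = ?u and S = "S P", OF _ s])
      fix \<delta> assume "\<delta> \<in> Pi (Pow \<Omega> - {{}}) (\<lambda>\<alpha>. \<alpha>)"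
      then show "D_sums_reg a (\<lambda>\<alpha>. ?u \<alpha> (\<delta> \<alpha>)) P (S P \<delta>)"
        unfolding choice_function_eq_Pi[symmetric]
        by (rule S_reg[OF P(1) below(2,3)[OF P(2)]])
    qed
    then obtain F where F: "F P \<subseteq> P \<and> finite (F P)" and F_close: "close P (F P)"
      if "P \<in> ?P" "refines \<Omega> P P2" for P
      by metis
    \<comment> \<open>\<open>F\<close> is controlled only at refinements of \<open>P2\<close>, but a truncation is finite everywhere.\<close>
    define \<Delta>1 where "\<Delta>1 P = (if refines \<Omega> P P2 then F P else {})" for P
    have "(P2, \<delta>1, \<Delta>1) \<in> ?I"
      using P2(1) \<delta>1 F by (auto simp: \<Delta>1_def truncation_def)
    moreover have "\<bar>?x i - z\<bar> \<le> 3 *\<^sub>R s + t" if "i \<in> ?I" "?le (P2, \<delta>1, \<Delta>1) i" for i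
    proof -
      obtain Q \<delta> \<Delta> where i: "i = (Q, \<delta>, \<Delta>)"
        by (metis prod_cases3)
      have Q: "Q \<in> ?P" "refines \<Omega> Q P2" and \<delta>: "choice_function \<Omega> \<delta>"
        and \<Delta>: "\<Delta> Q \<subseteq> Q" "finite (\<Delta> Q)" and le: "\<Delta>1 Q \<subseteq> \<Delta> Q"
        using that refines_refl_partitions[of Q H \<Omega>] by (auto simp: i truncation_def Sion_le_def)
      have "\<bar>?x i - z\<bar> \<le> \<bar>?x i - S Q \<delta>\<bar> + \<bar>S Q \<delta> - z\<bar>"
        using abs_triangle_ineq[of "?x i - S Q \<delta>" "S Q \<delta> - z"] by simp
      also have "\<dots> \<le> 3 *\<^sub>R s + t"
      proof (rule add_mono)
        have "F Q \<subseteq> \<Delta> Q"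
          using le Q(2) by (simp add: \<Delta>1_def)
        then show "\<bar>?x i - S Q \<delta>\<bar> \<le> 3 *\<^sub>R s"
          using F_close[OF Q] \<Delta> \<delta> by (simp add: i close_def choice_function_eq_Pi)
        show "\<bar>S Q \<delta> - z\<bar> \<le> t"
          by (rule near_z[OF Q(1) below(1)[OF Q(2)] \<delta>])
      qed
      finally show ?thesis .
    qed
    moreover have "isLub UNIV (range (\<lambda>j. 3 *\<^sub>R a j (\<phi> j))) (3 *\<^sub>R s)"
      by (intro isLub_range_scaleR s) simp
    ultimately show ?thesis
      using t by (intro exI conjI bexI ballI impI)
  qed
  have "D_sequence (\<lambda>i j. 3 *\<^sub>R a i j)"
    using Da by (intro D_sequence_scaleR) simp_all
  then have "D_converges ?I ?le ?x z"
    using Db by (rule D_converges_two_regulators[OF directed_Sion_index[OF dir]]) (rule bound)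
  then show ?thesis
    unfolding Sion_integrable_def by blast
qed

end
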